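(* Let $X$ be a Banach space and let $Y$ be a separable linear subspace of $X$. If $X$ is uniformly micro-semitransitive, then there is a separable closed linear subspace $Z$ of $X$ with $Y\subseteq Z$ which is uniformly micro-semitransitive (with the norm inherited from $X$). If $X$ is micro-transitive, then there is a separable closed linear subspace $Z$ of $X$ with $Y\subseteq Z$ which is micro-transitive (with the norm inherited from $X$).
   Context: Banach spaces are over $\mathbb{K}=\mathbb{R}$ or $\mathbb{C}$. $S_X$ is the unit sphere of $X$, $\mathcal{L}(X)$ the space of bounded linear operators on $X$ with the operator norm, and $\mathrm{Id}$ the identity operator. A Banach space $X$ (or its norm) is micro-transitive if the group $G$ of surjective linear isometries of $X$ (with the operator-norm topology) acts micro-transitively on $S_X$: for every $x\in S_X$ and every neighborhood $U$ of $\mathrm{Id}$ in $G$, the set $Ux=\{Tx : T\in U\}$ is a neighborhood of $x$ in $S_X$. A Banach space $X$ (or its norm) is uniformly micro-semitransitive if there is a function $\beta:(0,2)\to(0,\infty)$ such that whenever $\varepsilon\in(0,2)$ and $x,y\in S_X$ satisfy $\|x-y\|<\beta(\varepsilon)$, there is $T\in\mathcal{L}(X)$ with $\|T\|=1$, $Tx=y$ and $\|T-\mathrm{Id}\|<\varepsilon$. *)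

theory Defs
  imports "HOL-Analysis.Analysis"
begin

text \<open>The normed fields that are isometrically isomorphic to \<open>\<real>\<close> or \<open>\<complex>\<close>.\<close>

class real_or_complex = real_normed_field +
  assumes real_or_complex:
    "\<exists>f :: 'a \<Rightarrow> complex.
       (\<forall>a b. f (a + b) = f a + f b) \<and> (\<forall>a b. f (a * b) = f a * f b) \<and>
       (\<forall>r a. f (r *\<^sub>R a) = r *\<^sub>R f a) \<and> (\<forall>a. cmod (f a) = norm a) \<and>
       (range f = \<real> \<or> range f = UNIV)"

instance real :: real_or_complex
proof
  show "\<exists>f :: real \<Rightarrow> complex.
       (\<forall>a b. f (a + b) = f a + f b) \<and> (\<forall>a b. f (a * b) = f a * f b) \<and>
       (\<forall>r a. f (r *\<^sub>R a) = r *\<^sub>R f a) \<and> (\<forall>a. cmod (f a) = norm a) \<and>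
       (range f = \<real> \<or> range f = UNIV)"
    by (rule exI[of _ complex_of_real]) (auto simp: Reals_def scaleR_conv_of_real)
qed

instance complex :: real_or_complex
proof
  show "\<exists>f :: complex \<Rightarrow> complex.
       (\<forall>a b. f (a + b) = f a + f b) \<and> (\<forall>a b. f (a * b) = f a * f b) \<and>
       (\<forall>r a. f (r *\<^sub>R a) = r *\<^sub>R f a) \<and> (\<forall>a. cmod (f a) = norm a) \<and>
       (range f = \<real> \<or> range f = UNIV)"
    by (rule exI[of _ "\<lambda>z. z"]) auto
qed

text \<open>
  A Banach space over \<open>\<real>\<close> or \<open>\<complex>\<close>: the library provides complete normed spaces over \<open>\<real>\<close> only,
  so the scalar multiplication is an explicit operation extending \<^const>\<open>scaleR\<close>.
\<close>

locale banach_space_over = vector_space smul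
  for smul :: "'k::real_or_complex \<Rightarrow> 'x::banach \<Rightarrow> 'x" +
  assumes scale_of_real: "smul (of_real r) x = r *\<^sub>R x"
    and norm_scale: "norm (smul c x) = norm c * norm x"

lemma banach_space_over_scaleR: "banach_space_over (scaleR :: real \<Rightarrow> 'x::banach \<Rightarrow> 'x)"
  by unfold_locales (simp_all add: algebra_simps)

lemma banach_space_over_complex: "banach_space_over ((*) :: complex \<Rightarrow> complex \<Rightarrow> complex)"
  by unfold_locales (auto simp: algebra_simps norm_mult scaleR_conv_of_real)

text \<open>
  The following notions are taken relative to a linear subspace \<open>Z\<close>, regarded as a normed space
  with the inherited norm; the whole space is \<open>Z = UNIV\<close>. Operators on \<open>Z\<close> are represented by
  functions that are \<^const>\<open>undefined\<close> outside \<open>Z\<close>, so that distinct functions are distinct operators.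
\<close>

definition unit_sphere :: "'x::real_normed_vector set \<Rightarrow> 'x set" where
  "unit_sphere Z = {x \<in> Z. norm x = 1}"

definition bounded_operators :: "('k \<Rightarrow> 'x \<Rightarrow> 'x) \<Rightarrow> 'x set \<Rightarrow> ('x::real_normed_vector \<Rightarrow> 'x) set" where
  "bounded_operators smul Z = {T \<in> Z \<rightarrow>\<^sub>E Z.
     (\<forall>x\<in>Z. \<forall>y\<in>Z. T (x + y) = T x + T y) \<and>
     (\<forall>c. \<forall>x\<in>Z. T (smul c x) = smul c (T x)) \<and>
     (\<exists>B. \<forall>x\<in>Z. norm (T x) \<le> B * norm x)}"

definition onorm_on :: "'x::real_normed_vector set \<Rightarrow> ('x \<Rightarrow> 'x) \<Rightarrow> real" where
  "onorm_on Z T = (SUP x\<in>Z. norm (T x) / norm x)"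

definition isometry_group :: "('k \<Rightarrow> 'x \<Rightarrow> 'x) \<Rightarrow> 'x set \<Rightarrow> ('x::real_normed_vector \<Rightarrow> 'x) set" where
  "isometry_group smul Z =
     {T \<in> bounded_operators smul Z. T ` Z = Z \<and> (\<forall>x\<in>Z. norm (T x) = norm x)}"

text \<open>The value \<open>0\<close> off the group only serves to satisfy the locale \<open>Metric_space\<close>, whose
  non-negativity axiom is not relativized to the carrier.\<close>

definition isometry_dist ::
    "('k \<Rightarrow> 'x \<Rightarrow> 'x) \<Rightarrow> 'x set \<Rightarrow> ('x::real_normed_vector \<Rightarrow> 'x) \<Rightarrow> ('x \<Rightarrow> 'x) \<Rightarrow> real" where
  "isometry_dist smul Z S T =
     (if S \<in> isometry_group smul Z \<and> T \<in> isometry_group smul Z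
      then onorm_on Z (\<lambda>z. S z - T z) else 0)"

definition isometry_topology ::
    "('k \<Rightarrow> 'x \<Rightarrow> 'x) \<Rightarrow> 'x set \<Rightarrow> ('x::real_normed_vector \<Rightarrow> 'x) topology" where
  "isometry_topology smul Z =
     Metric_space.mtopology (isometry_group smul Z) (isometry_dist smul Z)"

text \<open>Neighborhoods need not be open.\<close>

definition neighborhood_in :: "'a topology \<Rightarrow> 'a \<Rightarrow> 'a set \<Rightarrow> bool" where
  "neighborhood_in \<tau> a N \<longleftrightarrow> N \<subseteq> topspace \<tau> \<and> (\<exists>V. openin \<tau> V \<and> a \<in> V \<and> V \<subseteq> N)"

definition micro_transitive :: "('k \<Rightarrow> 'x \<Rightarrow> 'x) \<Rightarrow> 'x::real_normed_vector set \<Rightarrow> bool" where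
  "micro_transitive smul Z \<longleftrightarrow>
     (\<forall>x\<in>unit_sphere Z. \<forall>U. neighborhood_in (isometry_topology smul Z) (restrict id Z) U \<longrightarrow>
        neighborhood_in (top_of_set (unit_sphere Z)) x ((\<lambda>T. T x) ` U))"

definition uniformly_micro_semitransitive ::
    "('k \<Rightarrow> 'x \<Rightarrow> 'x) \<Rightarrow> 'x::real_normed_vector set \<Rightarrow> bool" where
  "uniformly_micro_semitransitive smul Z \<longleftrightarrow>
     (\<exists>\<beta> :: real \<Rightarrow> real. (\<forall>\<epsilon>\<in>{0<..<2}. \<beta> \<epsilon> > 0) \<and>
        (\<forall>\<epsilon>\<in>{0<..<2}. \<forall>x\<in>unit_sphere Z. \<forall>y\<in>unit_sphere Z. norm (x - y) < \<beta> \<epsilon> \<longrightarrow>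
           (\<exists>T\<in>bounded_operators smul Z.
              onorm_on Z T = 1 \<and> T x = y \<and> onorm_on Z (\<lambda>z. T z - z) < \<epsilon>)))"

lemma onorm_on_UNIV: "onorm_on UNIV T = onorm T"
  by (simp add: onorm_on_def onorm_def)

lemma bounded_operators_UNIV: "bounded_operators scaleR UNIV = Collect bounded_linear"
  apply (auto simp: bounded_operators_def bounded_linear_def bounded_linear_axioms_def linear_iff)
  by (metis mult.commute)+

lemma onorm_on_upper:
  assumes "\<And>z. z \<in> Z \<Longrightarrow> norm (T z) \<le> B * norm z" "x \<in> Z"
  shows "norm (T x) / norm x \<le> onorm_on Z T"
  unfolding onorm_on_def
proof (rule cSUP_upper[OF \<open>x \<in> Z\<close>], rule bdd_aboveI2)
  fix z assume "z \<in> Z"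
  then have "norm (T z) \<le> \<bar>B\<bar> * norm z"
    using assms(1)[of z] by (meson abs_ge_self mult_right_mono norm_ge_zero order_trans)
  then show "norm (T z) / norm z \<le> \<bar>B\<bar>"
    by (cases "norm z = 0") (auto simp: divide_simps mult.commute)
qed

lemma onorm_on_bound:
  assumes "\<And>z. z \<in> Z \<Longrightarrow> norm (T z) \<le> B * norm z" "x \<in> Z"
  shows "norm (T x) \<le> onorm_on Z T * norm x"
  using onorm_on_upper[OF assms] assms(1)[OF assms(2)]
  by (cases "norm x = 0") (auto simp: divide_simps mult.commute split: if_splits)

lemma Metric_space_isometry:
  fixes smul :: "'k::real_or_complex \<Rightarrow> 'x::banach \<Rightarrow> 'x"
  assumes "banach_space_over smul" "module.subspace smul Z"
  shows "Metric_space (isometry_group smul Z) (isometry_dist smul Z)"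
proof -
  interpret banach_space_over smul by fact
  let ?G = "isometry_group smul Z"
  have ne: "0 \<in> Z" using assms(2) by (simp add: subspace_def)
  have b: "norm (S z - T z) \<le> 2 * norm z" if "S \<in> ?G" "T \<in> ?G" "z \<in> Z" for S T z
    using that norm_triangle_ineq4[of "S z" "T z"] by (simp add: isometry_group_def)
  show ?thesis
  proof
    fix S T
    show "0 \<le> isometry_dist smul Z S T"
      using onorm_on_upper[where Z=Z and x=0 and B=2 and T="\<lambda>z. S z - T z"] b ne
      by (auto simp: isometry_dist_def)
    show "isometry_dist smul Z S T = isometry_dist smul Z T S"
      by (auto simp: isometry_dist_def onorm_on_def norm_minus_commute)
  next
    fix S T assume G: "S \<in> ?G" "T \<in> ?G"
    have ext: "S \<in> extensional Z" "T \<in> extensional Z"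
      using G by (auto simp: isometry_group_def bounded_operators_def PiE_def)
    show "isometry_dist smul Z S T = 0 \<longleftrightarrow> S = T"
    proof
      assume "isometry_dist smul Z S T = 0"
      then have "norm (S z - T z) \<le> 0" if "z \<in> Z" for z
        using onorm_on_bound[where Z=Z and x=z and B=2 and T="\<lambda>z. S z - T z"] b G that
        by (auto simp: isometry_dist_def)
      then show "S = T" using ext by (intro extensionalityI) auto
    next
      assume "S = T" then show "isometry_dist smul Z S T = 0"
        using cSUP_const[of Z "0::real"] ne by (cases "Z = {}") (auto simp: isometry_dist_def onorm_on_def)
    qed
  next
    fix S T R assume G: "S \<in> ?G" "T \<in> ?G" "R \<in> ?G"
    have "onorm_on Z (\<lambda>z. S z - R z)
        \<le> onorm_on Z (\<lambda>z. S z - T z) + onorm_on Z (\<lambda>z. T z - R z)"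
      unfolding onorm_on_def[of Z "\<lambda>z. S z - R z"]
    proof (rule cSUP_least)
      show "Z \<noteq> {}" using ne by auto
      fix z assume z: "z \<in> Z"
      have "norm (S z - R z) \<le> norm (S z - T z) + norm (T z - R z)"
        using norm_triangle_ineq[of "S z - T z" "T z - R z"] by simp
      then have "norm (S z - R z) / norm z \<le> norm (S z - T z) / norm z + norm (T z - R z) / norm z"
        by (metis add_divide_distrib divide_right_mono norm_ge_zero)
      then show "norm (S z - R z) / norm z \<le> onorm_on Z (\<lambda>z. S z - T z) + onorm_on Z (\<lambda>z. T z - R z)"
        using onorm_on_upper[where Z=Z and x=z and B=2 and T="\<lambda>z. S z - T z"]
          onorm_on_upper[where Z=Z and x=z and B=2 and T="\<lambda>z. T z - R z"] b G z by fastforce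
    qed
    then show "isometry_dist smul Z S R \<le> isometry_dist smul Z S T + isometry_dist smul Z T R"
      using G by (simp add: isometry_dist_def)
  qed
qed

lemma id_in_isometry_group:
  fixes smul :: "'k::real_or_complex \<Rightarrow> 'x::banach \<Rightarrow> 'x"
  assumes "banach_space_over smul" "module.subspace smul Z"
  shows "restrict id Z \<in> isometry_group smul Z"
proof -
  interpret banach_space_over smul by fact
  have "\<exists>B. \<forall>x\<in>Z. norm x \<le> B * norm x" by (rule exI[of _ 1]) simp
  then show ?thesis
    using assms(2) by (auto simp: isometry_group_def bounded_operators_def subspace_def)
qed

end

theory Submission
  imports Defs
begin

text \<open>
  The closure \<open>Z\<close> of a countable set that is stable under sums, under a countable dense set of scalars
  and under countably many chosen operators (and their inverses) carries operators that realise the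
  hypothesis for pairs in a dense subset \<open>D\<close> of its sphere. Exact transport between arbitrary points
  \<open>x\<close>, \<open>y\<close> of the sphere is then obtained as a limit: for fast sequences \<open>X n \<longlonglongrightarrow> x\<close> and \<open>Y n \<longlonglongrightarrow> y\<close> in \<open>D\<close>,
  an operator taking \<open>X n\<close> to \<open>Y n\<close> is multiplied on the left and on the right by operators close to
  the identity to take \<open>X (n + 1)\<close> to \<open>Y (n + 1)\<close>, and these products converge in operator norm.
  In the micro-transitive case the admissible radius is uniform only along an orbit of the isometry
  group, but orbits are open in the sphere, so it suffices to approximate within one orbit.
\<close>

section \<open>Transport between limits of a set on which transport is known\<close>

text \<open>\<open>M\<close> is left abstract to serve for contractions and for isometries alike.
  Closure under composition keeps the corrected products in \<open>M\<close>, and the bound 1 on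
  norms keeps each correction as small in the product as it is by itself.\<close>

lemma closure_transitive:
  fixes M :: "('x::banach \<Rightarrow>\<^sub>L 'x) set"
  assumes "closed M" and comp: "\<And>S T. S \<in> M \<Longrightarrow> T \<in> M \<Longrightarrow> S o\<^sub>L T \<in> M"
    and contr: "\<And>T. T \<in> M \<Longrightarrow> norm T \<le> 1"
    and near: "\<And>e. e > 0 \<Longrightarrow> \<exists>d>0. \<forall>u\<in>D. \<forall>v\<in>D. norm (u - v) < d \<longrightarrow>
      (\<exists>T\<in>M. blinfun_apply T u = v \<and> norm (T - id_blinfun) < e)"
    and "e > 0"
  shows "\<exists>d>0. \<forall>x\<in>closure D. \<forall>y\<in>closure D. norm (x - y) < d \<longrightarrow>
      (\<exists>T\<in>M. blinfun_apply T x = y \<and> norm (T - id_blinfun) < e)"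
proof -
  obtain d0 where d0: "d0 > 0" "\<And>u v. u \<in> D \<Longrightarrow> v \<in> D \<Longrightarrow> norm (u - v) < d0 \<Longrightarrow>
      \<exists>T\<in>M. blinfun_apply T u = v \<and> norm (T - id_blinfun) < e / 2"
    using near[of "e/2"] \<open>e > 0\<close> by (meson half_gt_zero)
  \<comment> \<open>Each stage makes two corrections of size \<open>a n\<close>, hence changes the
    product by at most \<open>e / 8 * (1/2) ^ n\<close>. These changes add up to
    \<open>e / 4\<close>, which together with the \<open>e / 2\<close> allowed for \<open>T0\<close>
    stays below \<open>e\<close>.\<close>
  define a where "a n = e / 16 * (1/2) ^ n" for n :: nat
  have "\<exists>d>0. \<forall>u\<in>D. \<forall>v\<in>D. norm (u - v) < d \<longrightarrow>
      (\<exists>T\<in>M. blinfun_apply T u = v \<and> norm (T - id_blinfun) < a n)" for n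
    using near[of "a n"] \<open>e > 0\<close> by (simp add: a_def)
  then obtain d where d: "\<And>n. d n > 0" "\<And>n u v. u \<in> D \<Longrightarrow> v \<in> D \<Longrightarrow> norm (u - v) < d n \<Longrightarrow>
      \<exists>T\<in>M. blinfun_apply T u = v \<and> norm (T - id_blinfun) < a n"
    by metis
  show ?thesis
  proof (intro exI[of _ d0] conjI ballI impI \<open>d0 > 0\<close>)
    fix x y assume xy: "x \<in> closure D" "y \<in> closure D" "norm (x - y) < d0"
    \<comment> \<open>The entries \<open>d n / 2\<close> and \<open>d (n - 1) / 2\<close> put the
      terms \<open>n\<close> and \<open>Suc n\<close> of a sequence within \<open>d n\<close> of
      each other. The third entry keeps the initial pair within \<open>d0\<close>, and the last one
      forces convergence.\<close>
    define r where "r n = Min {d n / 2, d (n - 1) / 2, (d0 - norm (x - y)) / 2, inverse (real (Suc n))}" for n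
    have r: "r n > 0" "r n \<le> d n / 2" "r (Suc n) \<le> d n / 2"
      "r n \<le> (d0 - norm (x - y)) / 2" "r n \<le> inverse (real (Suc n))" for n
      using d(1) xy(3) unfolding r_def by simp (rule Min_le; simp)+
    have approx: "\<exists>X. \<forall>n. X n \<in> D \<and> norm (X n - z) < r n" if "z \<in> closure D" for z
      using that r(1) by (intro choice) (auto simp: closure_approachable dist_norm)
    have lim: "X \<longlonglongrightarrow> z" if "\<And>n. norm (X n - z) < r n" for X and z :: 'x
    proof (rule LIM_zero_cancel, rule Lim_null_comparison)
      show "\<forall>\<^sub>F n in sequentially. norm (X n - z) \<le> inverse (real (Suc n))"
        using that r(5) by (intro always_eventually allI) (meson less_le_trans less_imp_le)
      show "(\<lambda>n. inverse (real (Suc n))) \<longlonglongrightarrow> 0"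
        by (rule LIMSEQ_inverse_real_of_nat)
    qed
    have step: "norm (X n - X (Suc n)) < d n" if "\<And>n. norm (X n - z) < r n" for X n and z :: 'x
      using that[of n] that[of "Suc n"] r(2)[of n] r(3)[of n]
        norm_triangle_ineq4[of "X n - z" "X (Suc n) - z"] by simp
    obtain X where X: "\<And>n. X n \<in> D" "\<And>n. norm (X n - x) < r n" using approx xy(1) by metis
    obtain Y where Y: "\<And>n. Y n \<in> D" "\<And>n. norm (Y n - y) < r n" using approx xy(2) by metis
    have "norm (X 0 - Y 0) < d0"
      using X(2)[of 0] Y(2)[of 0] r(4)[of 0] norm_triangle_ineq4[of "X 0 - x" "Y 0 - y"]
        norm_triangle_ineq[of "X 0 - x - (Y 0 - y)" "x - y"] by (simp add: algebra_simps)
    then obtain T0 where T0: "T0 \<in> M" "T0 (X 0) = Y 0" "norm (T0 - id_blinfun) < e / 2"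
      using d0(2) X Y by blast
    \<comment> \<open>\<open>A n\<close> leads backwards from \<open>X (Suc n)\<close> to
      \<open>X n\<close>: it is composed on the right, so that \<open>T n\<close> can act next,
      while \<open>B n\<close> leads forwards on the left.\<close>
    have "\<exists>A\<in>M. blinfun_apply A (X (Suc n)) = X n \<and> norm (A - id_blinfun) < a n" for n
      using d(2)[of "X (Suc n)" "X n" n] X(1) step[of X, OF X(2)] by (simp add: norm_minus_commute)
    then obtain A where A: "\<And>n. A n \<in> M" "\<And>n. A n (X (Suc n)) = X n"
        "\<And>n. norm (A n - id_blinfun) < a n" by metis
    have "\<exists>B\<in>M. blinfun_apply B (Y n) = Y (Suc n) \<and> norm (B - id_blinfun) < a n" for n
      using d(2)[of "Y n" "Y (Suc n)" n] Y(1) step[of Y, OF Y(2)] by simp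
    then obtain B where B: "\<And>n. B n \<in> M" "\<And>n. B n (Y n) = Y (Suc n)"
        "\<And>n. norm (B n - id_blinfun) < a n" by metis
    define T where "T = rec_nat T0 (\<lambda>n S. B n o\<^sub>L (S o\<^sub>L A n))"
    have T_simps: "T 0 = T0" "T (Suc n) = B n o\<^sub>L (T n o\<^sub>L A n)" for n by (simp_all add: T_def)
    have TM: "T n \<in> M" for n by (induction n) (simp_all add: T_simps comp T0 A B)
    have TX: "T n (X n) = Y n" for n by (induction n) (simp_all add: T_simps T0 A B)
    have diff: "norm (T (Suc n) - T n) \<le> e / 8 * (1/2) ^ n" for n
    proof -
      \<comment> \<open>Adding and subtracting \<open>T n o\<^sub>L A n\<close> isolates the left
        correction from the right one.\<close>
      have "T (Suc n) - T n = ((B n - id_blinfun) o\<^sub>L (T n o\<^sub>L A n)) + (T n o\<^sub>L (A n - id_blinfun))"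
        by (rule blinfun_eqI) (simp add: T_simps blinfun.diff_left blinfun.diff_right blinfun.add_left)
      also have "norm \<dots> \<le> norm (B n - id_blinfun) * norm (T n o\<^sub>L A n) + norm (T n) * norm (A n - id_blinfun)"
        by (rule order_trans[OF norm_triangle_ineq add_mono]) (rule norm_blinfun_compose)+
      also have "\<dots> \<le> a n * 1 + 1 * a n"
        using less_imp_le[OF A(3)[of n]] less_imp_le[OF B(3)[of n]] contr[OF TM[of n]]
          contr[OF comp[OF TM A(1), of n n]] \<open>e > 0\<close>
        by (intro add_mono mult_mono) (simp_all add: a_def)
      finally show ?thesis by (simp add: a_def)
    qed
    have "(\<lambda>n. e / 8 * (1/2) ^ n) sums (e / 8 * (1 / (1 - 1/2)))"
      by (intro sums_mult geometric_sums) simp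
    then have geo: "(\<lambda>n. e / 8 * (1/2) ^ n) sums (e / 4)" by simp
    have sn: "summable (\<lambda>n. norm (T (Suc n) - T n))"
      by (rule summable_comparison_test_ev[OF _ sums_summable[OF geo]]) (use diff in auto)
    \<comment> \<open>The telescoping series converges absolutely, hence converges in the complete
      space of bounded operators. Norm convergence is what allows the limit of
      \<open>T n (X n)\<close> to be taken in both arguments at once.\<close>
    define L where "L = T0 + (\<Sum>n. T (Suc n) - T n)"
    have "(\<lambda>n. T0 + (\<Sum>i<n. T (Suc i) - T i)) \<longlonglongrightarrow> L"
      unfolding L_def by (intro tendsto_intros summable_LIMSEQ summable_norm_cancel[OF sn])
    then have TL: "T \<longlonglongrightarrow> L" by (simp add: sum_lessThan_telescope T_simps(1))
    have LM: "L \<in> M" using closed_sequentially[OF \<open>closed M\<close> _ TL] TM by blast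
    have "(\<lambda>n. T n (X n)) \<longlonglongrightarrow> L x" by (intro blinfun.tendsto TL lim X)
    then have Lx: "L x = y" using lim[of Y, OF Y(2)] unfolding TX by (rule LIMSEQ_unique)
    have "norm (\<Sum>n. T (Suc n) - T n) \<le> (\<Sum>n. norm (T (Suc n) - T n))" by (rule summable_norm[OF sn])
    also have "\<dots> \<le> e / 4" using suminf_le[OF diff sn sums_summable[OF geo]] sums_unique[OF geo] by simp
    finally have "norm (L - id_blinfun) < e"
      using T0(3) \<open>e > 0\<close> norm_triangle_ineq[of "T0 - id_blinfun" "\<Sum>n. T (Suc n) - T n"]
      by (simp add: L_def algebra_simps)
    then show "\<exists>T\<in>M. blinfun_apply T x = y \<and> norm (T - id_blinfun) < e" using LM Lx by blast
  qed
qed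

section \<open>Countable generation, dense scalars and operator norms\<close>

text \<open>Three arguments are provided for because an operator will be selected by a pair of
  points and then evaluated at a third. Three elements that appear at stages \<open>i\<close>,
  \<open>j\<close>, \<open>k\<close> are all present at stage \<open>i + j + k\<close>, the stages
  being increasing.\<close>

lemma countable_closure:
  fixes g :: "'a \<Rightarrow> 'a \<Rightarrow> 'a \<Rightarrow> 'a set"
  assumes "countable A" "\<And>u v w. countable (g u v w)"
  obtains C where "countable C" "A \<subseteq> C" "\<forall>u\<in>C. \<forall>v\<in>C. \<forall>w\<in>C. g u v w \<subseteq> C"
proof -
  define s where "s B = B \<union> (\<Union>u\<in>B. \<Union>v\<in>B. \<Union>w\<in>B. g u v w)" for B
  define E where "E n = (s ^^ n) A" for n
  have E_Suc: "E (Suc n) = s (E n)" for n by (simp add: E_def)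
  have "countable (E n)" for n
    by (induction n) (simp_all add: E_def s_def assms)
  moreover have "mono E" by (rule incseq_SucI) (auto simp: E_Suc s_def)
  moreover have "g u v w \<subseteq> (\<Union>n. E n)" if uvw: "u \<in> (\<Union>n. E n)" "v \<in> (\<Union>n. E n)" "w \<in> (\<Union>n. E n)" for u v w
  proof -
    obtain i j k where "u \<in> E i" "v \<in> E j" "w \<in> E k" using uvw by blast
    moreover define m where "m = i + j + k"
    ultimately have "u \<in> E m" "v \<in> E m" "w \<in> E m"
      using monoD[OF \<open>mono E\<close>, of i m] monoD[OF \<open>mono E\<close>, of j m] monoD[OF \<open>mono E\<close>, of k m] by auto
    then have "g u v w \<subseteq> E (Suc m)" by (auto simp: E_Suc s_def)
    then show ?thesis by blast
  qed
  moreover have "A \<subseteq> (\<Union>n. E n)" by (rule order_trans[OF _ UN_upper[of 0]]) (simp_all add: E_def)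
  ultimately show thesis by (intro that[of "\<Union>n. E n"]) auto
qed

text \<open>The scalars embed isometrically in the complex numbers. A countable dense subset of the
  range, chosen inside the range, is pulled back along this injection.\<close>

lemma countable_dense_real_or_complex:
  obtains Q :: "'k::real_or_complex set" where "countable Q" "closure Q = UNIV"
proof -
  obtain f :: "'k \<Rightarrow> complex" where f: "\<And>a b. f (a + b) = f a + f b" "\<And>a. cmod (f a) = norm a"
    using real_or_complex by blast
  have "f (a - b) = f a - f b" for a b using f(1)[of "a - b" b] by simp
  then have dist_f: "dist (f a) (f b) = dist a b" for a b by (metis dist_norm f(2))
  then have "inj f" by (metis injI dist_eq_0_iff)
  obtain P where P: "countable P" "P \<subseteq> range f" "range f \<subseteq> closure P" by (rule separable)
  have "\<exists>q\<in>f -` P. dist q a < e" if e: "e > 0" for a e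
  proof -
    have "f a \<in> closure P" using P by blast
    then obtain p where "p \<in> P" "dist p (f a) < e" using e by (auto simp: closure_approachable)
    moreover from this obtain q where "p = f q" using P(2) by blast
    ultimately show ?thesis by (auto simp: dist_f)
  qed
  then have "closure (f -` P) = UNIV" by (auto simp: closure_approachable)
  moreover have "countable (f -` P)"
    using P(1) \<open>inj f\<close>
    by (meson countable_image_inj_on countable_subset image_vimage_subset inj_on_subset subset_UNIV)
  ultimately show thesis by (rule that[rotated])
qed

lemma onorm_on_le:
  assumes "Z \<noteq> {}" "0 \<le> b" "\<And>z. z \<in> Z \<Longrightarrow> norm (f z) \<le> b * norm z"
  shows "onorm_on Z f \<le> b"
  unfolding onorm_on_def
proof (rule cSUP_least[OF \<open>Z \<noteq> {}\<close>])
  fix z assume "z \<in> Z"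
  then show "norm (f z) / norm z \<le> b"
    \<comment> \<open>At \<open>z = 0\<close> the quotient is 0 by the convention for division by
      zero; the assumption \<open>0 \<le> b\<close> covers this case.\<close>
    using assms by (cases "z = 0") (auto simp: divide_simps)
qed

lemma norm_Blinfun_diff_id:
  assumes "bounded_linear T"
  shows "norm (Blinfun T - id_blinfun) = onorm_on UNIV (\<lambda>z. T z - z)"
  by (simp add: norm_blinfun.rep_eq onorm_on_UNIV minus_blinfun.rep_eq bounded_linear_Blinfun_apply assms)

text \<open>Having \<open>closure B\<close> rather than \<open>B\<close> in the assumption lets the
  result be applied again in a second variable, so that an operation in two variables is extended to
  closures one variable at a time.\<close>

lemma image_closure_invariant:
  fixes f :: "'a::topological_space \<Rightarrow> 'b::topological_space"
  assumes "continuous_on UNIV f" "\<And>c. c \<in> C \<Longrightarrow> f c \<in> closure B" "z \<in> closure C"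
  shows "f z \<in> closure B"
  using image_closure_subset[of C f "closure B"] assms
  by (meson closed_closure continuous_on_subset image_subset_iff subset_UNIV)

section \<open>Separable reduction\<close>

context banach_space_over
begin

lemma bounded_linear_scale_right: "bounded_linear (smul c)"
proof (rule bounded_linear_intro)
  show "smul c (r *\<^sub>R x) = r *\<^sub>R smul c x" for r x
    by (metis scale_of_real scale_left_commute)
  show "norm (smul c x) \<le> norm x * norm c" for x by (simp add: norm_scale mult.commute)
qed (rule scale_right_distrib)

lemma bounded_linear_scale_left: "bounded_linear (\<lambda>c. smul c x)"
proof (rule bounded_linear_intro)
  show "smul (r *\<^sub>R c) x = r *\<^sub>R smul c x" for r c
    by (metis scale_of_real scale_scale scaleR_conv_of_real)
  show "norm (smul c x) \<le> norm c * norm x" for c by (simp add: norm_scale)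
qed (rule scale_left_distrib)

lemma real_subspace:
  assumes "subspace Z"
  shows "real_vector.subspace Z"
  using assms unfolding subspace_def real_vector.subspace_def by (metis scale_of_real)

lemma bounded_linear_operator:
  assumes "T \<in> bounded_operators smul UNIV"
  shows "bounded_linear T"
proof -
  from assms obtain B where B: "\<And>x. norm (T x) \<le> B * norm x"
    by (auto simp: bounded_operators_def)
  show ?thesis
  proof (rule bounded_linear_intro)
    show "T (r *\<^sub>R x) = r *\<^sub>R T x" for r x
      using assms by (simp add: bounded_operators_def flip: scale_of_real)
    show "norm (T x) \<le> norm x * B" for x using B by (simp add: mult.commute)
  qed (use assms in \<open>simp add: bounded_operators_def\<close>)
qed

text \<open>A Loewenheim-Skolem argument: one operator of \<open>G\<close> is fixed for each pair of
  normalised points of a countable set and each rational tolerance, and the set is closed under all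
  of them. The map \<open>h\<close> attaches to each chosen operator a companion, such as an
  inverse, that must preserve \<open>Z\<close> too.\<close>

lemma separable_reduction:
  fixes G :: "('x \<Rightarrow>\<^sub>L 'x) set" and h :: "('x \<Rightarrow>\<^sub>L 'x) \<Rightarrow> ('x \<Rightarrow>\<^sub>L 'x)"
  assumes "separable_space (top_of_set Y)"
  obtains Z D where "subspace Z" "closed Z" "separable_space (top_of_set Z)" "Y \<subseteq> Z"
    "D \<subseteq> unit_sphere Z" "unit_sphere Z \<subseteq> closure D"
    "\<forall>u\<in>D. \<forall>v\<in>D. \<forall>T\<in>G. \<forall>e>norm (T - id_blinfun). blinfun_apply T u = v \<longrightarrow>
       (\<exists>S\<in>G. blinfun_apply S u = v \<and> norm (S - id_blinfun) < e \<and>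
         blinfun_apply S ` Z \<subseteq> Z \<and> blinfun_apply (h S) ` Z \<subseteq> Z)"
proof -
  obtain C0 where C0: "countable C0" "C0 \<subseteq> Y" "Y \<subseteq> closure C0"
    using assms by (auto simp: separable_space_def closure_of_subtopology)
  obtain Q :: "'k set" where Q: "countable Q" "closure Q = UNIV"
    by (rule countable_dense_real_or_complex)
  define P where "P s t q T \<longleftrightarrow> T \<in> G \<and> blinfun_apply T s = t \<and> norm (T - id_blinfun) < q" for s t q T
  \<comment> \<open>Where no operator satisfies \<open>P\<close>, the value of \<open>F\<close> is
    arbitrary; closing under it as well does no harm to countability.\<close>
  define F where "F s t q = (SOME T. P s t q T)" for s t and q :: real
  \<comment> \<open>\<open>u\<close> and \<open>v\<close> are normalised by \<open>sgn\<close>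
    because the countable set is built in the whole space and not in its sphere.\<close>
  define g where "g u v w = insert (u + v) ((\<lambda>c. smul c u) ` Q) \<union>
    (\<Union>q\<in>\<rat>. {blinfun_apply (F (sgn u) (sgn v) q) w, blinfun_apply (h (F (sgn u) (sgn v) q)) w})" for u v w
  have g: "countable (g u v w)" for u v w
    using Q(1) by (auto simp: g_def countable_rat)
  have "countable (insert 0 C0)" using C0(1) by simp
  then obtain C where C: "countable C" "insert 0 C0 \<subseteq> C"
      "\<forall>u\<in>C. \<forall>v\<in>C. \<forall>w\<in>C. g u v w \<subseteq> C"
    by (rule countable_closure[of _ g, OF _ g])
  have C_add: "u + v \<in> C" if "u \<in> C" "v \<in> C" for u v
    using C(3)[rule_format, OF that that(1)] by (simp add: g_def)
  have C_scale: "smul c u \<in> C" if "c \<in> Q" "u \<in> C" for c u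
    using C(3)[rule_format, OF that(2) that(2) that(2)] that(1) by (auto simp: g_def)
  have C_F: "blinfun_apply (F (sgn u) (sgn v) q) w \<in> C" "blinfun_apply (h (F (sgn u) (sgn v) q)) w \<in> C"
    if "q \<in> \<rat>" "u \<in> C" "v \<in> C" "w \<in> C" for u v w q
    using C(3)[rule_format, OF that(2-4)] that(1) by (auto simp: g_def)
  define Z where "Z = closure C"
  have C_Z: "c \<in> Z" if "c \<in> C" for c using that closure_subset[of C] by (auto simp: Z_def)
  \<comment> \<open>Stability passes from \<open>C\<close> to its closure in two rounds: for sums
    first one summand and then the other, for scaling first the vector and then the scalar, where
    density of \<open>Q\<close> gives all scalars.\<close>
  have Z_add1: "z + c \<in> Z" if "z \<in> Z" "c \<in> C" for z c
    unfolding Z_def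
    by (rule image_closure_invariant[of "\<lambda>z. z + c" C])
      (use that C_add C_Z in \<open>auto simp: Z_def intro!: continuous_intros\<close>)
  have Z_add: "z + w \<in> Z" if "z \<in> Z" "w \<in> Z" for z w
    unfolding Z_def
    by (rule image_closure_invariant[of "\<lambda>w. z + w" C])
      (use that Z_add1 in \<open>auto simp: Z_def intro!: continuous_intros\<close>)
  have Z_scale1: "smul c z \<in> Z" if "c \<in> Q" "z \<in> Z" for c z
    unfolding Z_def
    by (rule image_closure_invariant[OF linear_continuous_on[OF bounded_linear_scale_right]])
      (use that C_scale C_Z in \<open>auto simp: Z_def\<close>)
  have Z_scale: "smul c z \<in> Z" if "z \<in> Z" for c z
    unfolding Z_def
    by (rule image_closure_invariant[OF linear_continuous_on[OF bounded_linear_scale_left], of Q])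
      (use that Z_scale1 Q(2) in \<open>auto simp: Z_def\<close>)
  have sub: "subspace Z"
    using Z_add Z_scale C_Z C(2) by (auto simp: subspace_def)
  have sep: "separable_space (top_of_set Z)"
    using C(1) C_Z by (auto simp: separable_space_def closure_of_subtopology Z_def Int_absorb1 closure_subset)
  have YZ: "Y \<subseteq> Z" using C0(3) C(2) closure_mono[of C0 C] by (auto simp: Z_def)
  define D where "D = sgn ` C - {0}"
  have DZ: "D \<subseteq> unit_sphere Z"
    using real_vector.subspace_scale[OF real_subspace[OF sub]] C_Z
    by (auto simp: D_def unit_sphere_def norm_sgn sgn_div_norm)
  have dense: "unit_sphere Z \<subseteq> closure D"
  proof
    fix x assume x: "x \<in> unit_sphere Z"
    then have "x \<noteq> 0" "sgn x = x" by (auto simp: unit_sphere_def sgn_div_norm)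
    \<comment> \<open>The complement of 0 is open, so \<open>x\<close> is a limit of nonzero points
      of \<open>C\<close>; \<open>sgn\<close> is continuous at \<open>x\<close> and carries them
      into \<open>D\<close>.\<close>
    then have "x \<in> closure (- {0} \<inter> C)"
      using x open_Int_closure_subset[of "- {0}" C] by (auto simp: unit_sphere_def Z_def)
    then obtain X where X: "\<And>n. X n \<in> - {0} \<inter> C" "X \<longlonglongrightarrow> x"
      by (auto simp: closure_sequential)
    have "(\<lambda>n. sgn (X n)) \<longlonglongrightarrow> x"
      using tendsto_sgn[OF X(2) \<open>x \<noteq> 0\<close>] \<open>sgn x = x\<close> by simp
    moreover have "\<forall>n. sgn (X n) \<in> D" using X(1) by (auto simp: D_def sgn_zero_iff)
    ultimately show "x \<in> closure D"
      unfolding closure_sequential by (intro exI[of _ "\<lambda>n. sgn (X n)"]) simp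
  qed
  have inv: "blinfun_apply T ` Z \<subseteq> Z" if "\<And>w. w \<in> C \<Longrightarrow> blinfun_apply T w \<in> C" for T
    using that C_Z unfolding Z_def
    by (auto intro: image_closure_invariant[OF linear_continuous_on[OF blinfun.bounded_linear_right], of C])
  show thesis
  proof (rule that[OF sub _ sep YZ DZ dense]; (intro ballI allI impI)?)
    show "closed Z" by (simp add: Z_def)
  next
    fix u v T e
    assume *: "u \<in> D" "v \<in> D" "T \<in> G" "norm (T - id_blinfun) < e" "blinfun_apply T u = v"
    \<comment> \<open>The strict inequality leaves room for a rational tolerance, one of the
      countably many for which a witness was fixed.\<close>
    then obtain q where q: "q \<in> \<rat>" "norm (T - id_blinfun) < q" "q < e"
      using Rats_dense_in_real by blast
    obtain u' v' where uv: "u' \<in> C" "v' \<in> C" "u = sgn u'" "v = sgn v'"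
      using * by (auto simp: D_def)
    have "P u v q T" using * q by (simp add: P_def)
    then have "P u v q (F u v q)" unfolding F_def by (rule someI)
    moreover have "blinfun_apply (F u v q) ` Z \<subseteq> Z" "blinfun_apply (h (F u v q)) ` Z \<subseteq> Z"
      unfolding uv by (rule inv, rule C_F; use q uv in simp)+
    ultimately show "\<exists>S\<in>G. blinfun_apply S u = v \<and> norm (S - id_blinfun) < e \<and>
         blinfun_apply S ` Z \<subseteq> Z \<and> blinfun_apply (h S) ` Z \<subseteq> Z"
      using q(3) unfolding P_def by (intro bexI[of _ "F u v q"]) auto
  qed
qed

section \<open>Contractions and isometries that preserve a subspace\<close>

text \<open>The operators live on the whole space and leave \<open>Z\<close> invariant, so products
  and norm limits are those of bounded operators. The type records real linearity only, whence the
  clause on \<open>smul\<close>. The bound 1, unlike norm exactly 1, passes to products.\<close>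

definition contractions :: "'x set \<Rightarrow> ('x \<Rightarrow>\<^sub>L 'x) set" where
  "contractions Z = {T. (\<forall>c x. blinfun_apply T (smul c x) = smul c (blinfun_apply T x)) \<and>
     norm T \<le> 1 \<and> blinfun_apply T ` Z \<subseteq> Z}"

text \<open>Surjectivity is required on \<open>Z\<close>. For \<open>Z = UNIV\<close> these are the
  surjective linear isometries of the whole space.\<close>

definition isometries :: "'x set \<Rightarrow> ('x \<Rightarrow>\<^sub>L 'x) set" where
  "isometries Z = {T \<in> contractions Z. (\<forall>x. norm (blinfun_apply T x) = norm x) \<and> blinfun_apply T ` Z = Z}"

lemma contractions_compose:
  assumes "S \<in> contractions Z" "T \<in> contractions Z"
  shows "S o\<^sub>L T \<in> contractions Z"
proof -
  have "norm (S o\<^sub>L T) \<le> norm S * norm T" by (rule norm_blinfun_compose)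
  also have "\<dots> \<le> 1" using assms by (intro mult_le_one) (auto simp: contractions_def)
  finally show ?thesis using assms by (simp add: contractions_def image_subset_iff)
qed

lemma isometries_compose: "S \<in> isometries Z \<Longrightarrow> T \<in> isometries Z \<Longrightarrow> S o\<^sub>L T \<in> isometries Z"
  by (simp add: isometries_def contractions_compose flip: image_image)

lemma isometriesI:
  assumes "\<And>c x. blinfun_apply T (smul c x) = smul c (blinfun_apply T x)"
    "\<And>x. norm (blinfun_apply T x) = norm x" "blinfun_apply T ` Z = Z"
  shows "T \<in> isometries Z"
  using assms norm_blinfun_bound[of 1 T] by (simp add: isometries_def contractions_def)

lemma closed_contractions:
  assumes "closed Z"
  shows "closed (contractions Z)"
  unfolding closed_sequential_limits
proof (intro allI impI, elim conjE)
  fix T L assume T: "\<forall>n. T n \<in> contractions Z" and lim: "T \<longlonglongrightarrow> L"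
  have ap: "(\<lambda>n. blinfun_apply (T n) x) \<longlonglongrightarrow> blinfun_apply L x" for x
    by (intro blinfun.tendsto lim tendsto_const)
  have "blinfun_apply L (smul c x) = smul c (blinfun_apply L x)" for c x
    using ap[of "smul c x"] bounded_linear.tendsto[OF bounded_linear_scale_right ap[of x], of c] T
    by (intro LIMSEQ_unique) (auto simp: contractions_def)
  moreover have "norm L \<le> 1"
    using T by (intro Lim_bounded[OF tendsto_norm[OF lim], of 0]) (auto simp: contractions_def)
  moreover have "blinfun_apply L z \<in> Z" if "z \<in> Z" for z
    using T that by (intro closed_sequentially[OF assms _ ap]) (auto simp: contractions_def)
  ultimately show "L \<in> contractions Z" by (auto simp: contractions_def)
qed

text \<open>The delicate clause is surjectivity of a limit \<open>L\<close>. The image of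
  \<open>Z\<close> under the isometric \<open>L\<close> is complete, hence closed. If
  \<open>T n\<close> maps \<open>w n\<close> to \<open>z\<close>, then \<open>w n\<close> has the
  norm of \<open>z\<close>, so \<open>L (w n)\<close> differs from \<open>z\<close> by at most
  \<open>norm (T n - L) * norm z\<close> and tends to \<open>z\<close>.\<close>

lemma closed_isometries:
  assumes "subspace Z" "closed Z"
  shows "closed (isometries Z)"
  unfolding closed_sequential_limits
proof (intro allI impI, elim conjE)
  fix T L assume T: "\<forall>n. T n \<in> isometries Z" and lim: "T \<longlonglongrightarrow> L"
  have L: "L \<in> contractions Z"
    using closed_sequentially[OF closed_contractions[OF assms(2)] _ lim] T by (auto simp: isometries_def)
  have nL: "norm (blinfun_apply L x) = norm x" for x
  proof (rule LIMSEQ_unique)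
    show "(\<lambda>n. norm (blinfun_apply (T n) x)) \<longlonglongrightarrow> norm (blinfun_apply L x)"
      by (intro tendsto_norm blinfun.tendsto lim tendsto_const)
    show "(\<lambda>n. norm (blinfun_apply (T n) x)) \<longlonglongrightarrow> norm x" using T by (simp add: isometries_def)
  qed
  have "complete (blinfun_apply L ` Z)"
    using assms nL by (intro complete_isometric_image[of 1])
      (auto simp: real_subspace blinfun.bounded_linear_right complete_eq_closed)
  then have cl: "closed (blinfun_apply L ` Z)" by (rule complete_imp_closed)
  have "z \<in> blinfun_apply L ` Z" if z: "z \<in> Z" for z
  proof -
    have "\<exists>w\<in>Z. blinfun_apply (T n) w = z \<and> norm w = norm z" for n
    proof -
      have iso: "blinfun_apply (T n) ` Z = Z" "norm (blinfun_apply (T n) w) = norm w" for w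
        using spec[OF T, of n] unfolding isometries_def by blast+
      obtain w where w: "w \<in> Z" "z = blinfun_apply (T n) w" using z iso(1) by blast
      then show ?thesis using iso(2)[of w] by (intro bexI[of _ w]) simp_all
    qed
    then obtain w where w: "\<And>n. w n \<in> Z" "\<And>n. blinfun_apply (T n) (w n) = z" "\<And>n. norm (w n) = norm z"
      by metis
    have "(\<lambda>n. blinfun_apply L (w n)) \<longlonglongrightarrow> z"
    proof (rule LIM_zero_cancel, rule Lim_null_comparison)
      have "norm (blinfun_apply L (w n) - z) \<le> norm (T n - L) * norm z" for n
        using norm_blinfun[of "L - T n" "w n"] w by (simp add: blinfun.diff_left norm_minus_commute)
      then show "\<forall>\<^sub>F n in sequentially. norm (blinfun_apply L (w n) - z) \<le> norm (T n - L) * norm z" by simp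
      show "(\<lambda>n. norm (T n - L) * norm z) \<longlonglongrightarrow> 0"
        by (intro tendsto_mult_left_zero tendsto_norm_zero LIM_zero lim)
    qed
    then show ?thesis by (rule closed_sequentially[OF cl imageI[OF w(1)]])
  qed
  then show "L \<in> isometries Z" using L nL by (auto simp: isometries_def contractions_def)
qed

lemma restrict_contraction:
  assumes "subspace Z" "T \<in> contractions Z"
  shows "restrict (blinfun_apply T) Z \<in> bounded_operators smul Z"
proof -
  have "\<exists>B. \<forall>x\<in>Z. norm (blinfun_apply T x) \<le> B * norm x" using norm_blinfun[of T] by blast
  then show ?thesis
    using assms by (auto simp: bounded_operators_def contractions_def subspace_def blinfun.add_right)
qed

lemma onorm_on_restrict_diff:
  assumes "subspace Z"
  shows "onorm_on Z (\<lambda>z. restrict (blinfun_apply T) Z z - z) \<le> norm (T - id_blinfun)"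
  using norm_blinfun[of "T - id_blinfun"] assms
  by (intro onorm_on_le) (auto simp: subspace_def blinfun.diff_left)

lemma Blinfun_contraction:
  assumes "T \<in> bounded_operators smul UNIV" "\<And>x. norm (T x) \<le> norm x"
  shows "Blinfun T \<in> contractions UNIV"
  using assms norm_blinfun_bound[of 1 "Blinfun T"]
  by (auto simp: contractions_def bounded_operators_def bounded_linear_Blinfun_apply bounded_linear_operator)

text \<open>Supplies the inverses for conjugation along an orbit and for the companion map in the
  separable reduction.\<close>

lemma isometries_inverse:
  assumes "T \<in> isometries UNIV"
  shows "\<exists>S\<in>isometries UNIV. S o\<^sub>L T = id_blinfun \<and> T o\<^sub>L S = id_blinfun"
proof -
  let ?T = "blinfun_apply T"
  have T: "\<And>c x. ?T (smul c x) = smul c (?T x)" "\<And>x. norm (?T x) = norm x" "surj ?T"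
    using assms by (auto simp: isometries_def contractions_def)
  have "inj ?T"
  proof (rule injI)
    fix x y assume "?T x = ?T y"
    then have "norm (?T (x - y)) = 0" by (simp add: blinfun.diff_right)
    then show "x = y" by (simp add: T)
  qed
  then have l: "inv ?T (?T x) = x" and r: "?T (inv ?T x) = x" for x
    using T(3) by (simp_all add: surj_f_inv_f)
  have n: "norm (inv ?T x) = norm x" for x by (metis T(2) r)
  have "bounded_linear (inv ?T)"
  proof (rule bounded_linear_intro)
    show "inv ?T (x + y) = inv ?T x + inv ?T y" for x y
      by (metis blinfun.add_right l r)
    show "inv ?T (c *\<^sub>R x) = c *\<^sub>R inv ?T x" for c x
      by (metis blinfun.scaleR_right l r)
    show "norm (inv ?T x) \<le> norm x * 1" for x by (simp add: n)
  qed
  then have ap: "blinfun_apply (Blinfun (inv ?T)) = inv ?T" by (rule bounded_linear_Blinfun_apply)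
  have "inv ?T (smul c x) = smul c (inv ?T x)" for c x by (metis T(1) l r)
  then have "Blinfun (inv ?T) \<in> isometries UNIV"
    using n \<open>inj ?T\<close> by (intro isometriesI) (auto simp: ap inj_imp_surj_inv)
  then show ?thesis
    by (intro bexI[of _ "Blinfun (inv ?T)"] conjI blinfun_eqI) (simp_all add: ap l r)
qed

section \<open>The uniformly micro-semitransitive case\<close>

lemma uniformly_micro_semitransitive_subspace:
  assumes "separable_space (top_of_set Y)" "uniformly_micro_semitransitive smul UNIV"
  obtains Z where "subspace Z" "closed Z" "separable_space (top_of_set Z)" "Y \<subseteq> Z"
    "uniformly_micro_semitransitive smul Z"
proof -
  obtain Z D where Z: "subspace Z" "closed Z" "separable_space (top_of_set Z)" "Y \<subseteq> Z"
    "D \<subseteq> unit_sphere Z" "unit_sphere Z \<subseteq> closure D"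
    and red: "\<forall>u\<in>D. \<forall>v\<in>D. \<forall>T\<in>contractions UNIV. \<forall>e>norm (T - id_blinfun). blinfun_apply T u = v \<longrightarrow>
       (\<exists>S\<in>contractions UNIV. blinfun_apply S u = v \<and> norm (S - id_blinfun) < e \<and>
         blinfun_apply S ` Z \<subseteq> Z \<and> blinfun_apply (id S) ` Z \<subseteq> Z)"
    by (rule separable_reduction[OF assms(1), of "contractions UNIV" id])
  obtain \<beta> where \<beta>: "\<forall>e\<in>{0<..<2}. \<beta> e > 0"
    "\<forall>e\<in>{0<..<2}. \<forall>x\<in>unit_sphere UNIV. \<forall>y\<in>unit_sphere UNIV. norm (x - y) < \<beta> e \<longrightarrow>
       (\<exists>T\<in>bounded_operators smul UNIV. onorm_on UNIV T = 1 \<and> T x = y \<and> onorm_on UNIV (\<lambda>z. T z - z) < e)"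
    using assms(2) unfolding uniformly_micro_semitransitive_def by blast
  have near: "\<exists>d>0. \<forall>u\<in>D. \<forall>v\<in>D. norm (u - v) < d \<longrightarrow>
      (\<exists>T\<in>contractions Z. blinfun_apply T u = v \<and> norm (T - id_blinfun) < e)" if e: "e > 0" for e
  \<comment> \<open>The modulus is controlled on the interval from 0 to 2 only, so large tolerances
    are cut down to 1.\<close>
  proof (intro exI[of _ "\<beta> (min e 1)"] conjI ballI impI)
    show "\<beta> (min e 1) > 0" using \<beta>(1) e by simp
    fix u v assume uv: "u \<in> D" "v \<in> D" "norm (u - v) < \<beta> (min e 1)"
    then have "u \<in> unit_sphere UNIV" "v \<in> unit_sphere UNIV" using Z(5) by (auto simp: unit_sphere_def)
    then obtain T where T: "T \<in> bounded_operators smul UNIV" "onorm_on UNIV T = 1" "T u = v"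
        "onorm_on UNIV (\<lambda>z. T z - z) < min e 1"
      using \<beta>(2)[rule_format, of "min e 1" u v] uv e by fastforce
    note bl = bounded_linear_operator[OF T(1)]
    have "norm (T x) \<le> norm x" for x
      using onorm[OF bl, of x] T(2) by (simp add: onorm_on_UNIV)
    then have "Blinfun T \<in> contractions UNIV" by (rule Blinfun_contraction[OF T(1)])
    then obtain S where "S \<in> contractions UNIV" "blinfun_apply S u = v" "norm (S - id_blinfun) < e"
        "blinfun_apply S ` Z \<subseteq> Z"
      using red[rule_format, OF uv(1,2), of "Blinfun T" e] T bl
      by (auto simp: norm_Blinfun_diff_id bounded_linear_Blinfun_apply)
    then show "\<exists>T\<in>contractions Z. blinfun_apply T u = v \<and> norm (T - id_blinfun) < e"
      by (auto simp: contractions_def)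
  qed
  have "\<exists>d>0. \<forall>x\<in>closure D. \<forall>y\<in>closure D. norm (x - y) < d \<longrightarrow>
      (\<exists>T\<in>contractions Z. blinfun_apply T x = y \<and> norm (T - id_blinfun) < e)" if "e > 0" for e
    by (rule closure_transitive[OF closed_contractions[OF Z(2)] contractions_compose _ near that])
      (auto simp: contractions_def)
  then obtain d where d: "\<And>e. e > 0 \<Longrightarrow> d e > 0" "\<And>e x y. e > 0 \<Longrightarrow> x \<in> closure D \<Longrightarrow> y \<in> closure D \<Longrightarrow>
      norm (x - y) < d e \<Longrightarrow> \<exists>T\<in>contractions Z. blinfun_apply T x = y \<and> norm (T - id_blinfun) < e"
    by metis
  have "uniformly_micro_semitransitive smul Z"
    unfolding uniformly_micro_semitransitive_def
  proof (intro exI[of _ d] conjI ballI impI)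
    fix e :: real assume e: "e \<in> {0<..<2}"
    then show "d e > 0" using d(1) by simp
    fix x y assume xy: "x \<in> unit_sphere Z" "y \<in> unit_sphere Z" "norm (x - y) < d e"
    then obtain T where T: "T \<in> contractions Z" "blinfun_apply T x = y" "norm (T - id_blinfun) < e"
      using d(2)[of e x y] e Z(6) by auto
    let ?T = "restrict (blinfun_apply T) Z"
    have x: "x \<in> Z" "norm x = 1" and y: "norm y = 1" using xy by (auto simp: unit_sphere_def)
    have le: "norm (?T z) \<le> 1 * norm z" if "z \<in> Z" for z
      using T(1) that order_trans[OF norm_blinfun[of T z] mult_right_mono[of "norm T" 1 "norm z"]]
      by (simp add: contractions_def)
    have "onorm_on Z ?T \<le> 1" using x le by (intro onorm_on_le) auto
    \<comment> \<open>The norm is attained at \<open>x\<close>, a unit vector sent to the unit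
      vector \<open>y\<close>.\<close>
    moreover have "1 \<le> onorm_on Z ?T"
      using onorm_on_upper[of Z ?T 1 x, OF le] x y T(2) by simp
    ultimately have "onorm_on Z ?T = 1" by simp
    moreover have "onorm_on Z (\<lambda>z. ?T z - z) < e"
      using onorm_on_restrict_diff[OF Z(1), of T] T(3) by simp
    ultimately show "\<exists>T\<in>bounded_operators smul Z.
        onorm_on Z T = 1 \<and> T x = y \<and> onorm_on Z (\<lambda>z. T z - z) < e"
      using restrict_contraction[OF Z(1) T(1)] x(1) T(2) by (intro bexI[of _ ?T]) auto
  qed
  then show thesis using that Z by blast
qed

section \<open>The micro-transitive case\<close>

text \<open>This is micro-transitivity tested on the ball of radius \<open>e\<close> about the
  identity in the isometry group, rewritten for bounded operators.\<close>

lemma micro_transitive_UNIV_near: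
  assumes "micro_transitive smul UNIV" "norm x = 1" "e > 0"
  shows "\<exists>d>0. \<forall>y. norm y = 1 \<longrightarrow> norm (x - y) < d \<longrightarrow>
    (\<exists>T\<in>isometries UNIV. blinfun_apply T x = y \<and> norm (T - id_blinfun) < e)"
proof -
  have sub: "subspace UNIV" by (simp add: subspace_def)
  interpret I: Metric_space "isometry_group smul UNIV" "isometry_dist smul UNIV"
    by (rule Metric_space_isometry[OF banach_space_over_axioms sub])
  have id_eq: "restrict id UNIV = (id :: 'x \<Rightarrow> 'x)" by auto
  have id: "id \<in> isometry_group smul UNIV"
    using id_in_isometry_group[OF banach_space_over_axioms sub] unfolding id_eq .
  define U where "U = I.mball id e"
  have "neighborhood_in (isometry_topology smul UNIV) id U"
    using id \<open>e > 0\<close> unfolding neighborhood_in_def isometry_topology_def U_def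
    by (auto intro!: exI[of _ "I.mball id e"])
  then have "neighborhood_in (top_of_set (unit_sphere UNIV)) x ((\<lambda>T. T x) ` U)"
    using assms unfolding micro_transitive_def unit_sphere_def id_eq by simp
  then obtain V where V: "openin (top_of_set (unit_sphere UNIV)) V" "x \<in> V" "V \<subseteq> (\<lambda>T. T x) ` U"
    by (auto simp: neighborhood_in_def)
  then obtain d where d: "d > 0" "\<And>y. y \<in> unit_sphere UNIV \<Longrightarrow> dist y x < d \<Longrightarrow> y \<in> V"
    unfolding openin_euclidean_subtopology_iff by blast
  show ?thesis
  proof (intro exI[of _ d] conjI allI impI d(1))
    fix y assume y: "norm y = 1" "norm (x - y) < d"
    then have "y \<in> V" using d(2)[of y] by (simp add: unit_sphere_def dist_norm norm_minus_commute)
    then obtain T where T: "T \<in> U" "y = T x" using V(3) by blast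
    then have G: "T \<in> isometry_group smul UNIV" and le: "onorm_on UNIV (\<lambda>z. T z - z) < e"
      using id by (auto simp: U_def I.commute isometry_dist_def onorm_on_def norm_minus_commute)
    have bo: "T \<in> bounded_operators smul UNIV" using G by (simp add: isometry_group_def)
    note bl = bounded_linear_operator[OF bo]
    have "Blinfun T \<in> isometries UNIV"
      using G by (intro isometriesI)
        (auto simp: bounded_linear_Blinfun_apply[OF bl] isometry_group_def bounded_operators_def)
    then show "\<exists>T\<in>isometries UNIV. blinfun_apply T x = y \<and> norm (T - id_blinfun) < e"
      using le T(2) by (intro bexI[of _ "Blinfun T"])
        (auto simp: norm_Blinfun_diff_id[OF bl] bounded_linear_Blinfun_apply[OF bl])
  qed
qed

text \<open>Conjugation by an isometry makes the radius uniform along an orbit.\<close>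

lemma micro_transitive_UNIV_near_orbit:
  assumes "micro_transitive smul UNIV" "norm x = 1" "e > 0"
  shows "\<exists>d>0. \<forall>R\<in>isometries UNIV. \<forall>y. norm y = 1 \<longrightarrow> norm (blinfun_apply R x - y) < d \<longrightarrow>
    (\<exists>T\<in>isometries UNIV. blinfun_apply T (blinfun_apply R x) = y \<and> norm (T - id_blinfun) < e)"
proof -
  obtain d where d: "d > 0" "\<And>y. norm y = 1 \<Longrightarrow> norm (x - y) < d \<Longrightarrow>
    \<exists>T\<in>isometries UNIV. blinfun_apply T x = y \<and> norm (T - id_blinfun) < e"
    using micro_transitive_UNIV_near[OF assms] by metis
  show ?thesis
  proof (intro exI[of _ d] conjI ballI allI impI d(1))
    fix R y assume R: "R \<in> isometries UNIV" and y: "norm y = 1" "norm (blinfun_apply R x - y) < d"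
    obtain S where S: "S \<in> isometries UNIV" "S o\<^sub>L R = id_blinfun" "R o\<^sub>L S = id_blinfun"
      using isometries_inverse[OF R] by blast
    have SR: "blinfun_apply S (blinfun_apply R z) = z" "blinfun_apply R (blinfun_apply S z) = z" for z
      using S(2,3) by (metis blinfun_apply_blinfun_compose blinfun_apply_id_blinfun)+
    have iso: "norm (blinfun_apply S z) = norm z" "norm (blinfun_apply R z) = norm z" for z
      using R S(1) by (auto simp: isometries_def)
    have "norm (x - blinfun_apply S y) < d"
      using y(2) iso(1)[of "blinfun_apply R x - y"] by (simp add: blinfun.diff_right SR)
    \<comment> \<open>\<open>y\<close> is pulled back by \<open>S\<close>, the inverse of
      \<open>R\<close>, to a point near \<open>x\<close>, where the radius \<open>d\<close> applies.
      The conjugate of \<open>T\<close> by \<open>R\<close> then takes \<open>R x\<close> to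
      \<open>y\<close> and is no further from the identity than \<open>T\<close>.\<close>
    then obtain T where T: "T \<in> isometries UNIV" "blinfun_apply T x = blinfun_apply S y"
        "norm (T - id_blinfun) < e"
      using d(2)[of "blinfun_apply S y"] iso y by auto
    have "norm ((R o\<^sub>L (T o\<^sub>L S)) - id_blinfun) \<le> norm (T - id_blinfun)"
    proof (rule norm_blinfun_bound)
      fix z
      have "blinfun_apply ((R o\<^sub>L (T o\<^sub>L S)) - id_blinfun) z
          = blinfun_apply R (blinfun_apply (T - id_blinfun) (blinfun_apply S z))"
        by (simp add: blinfun.diff_left blinfun.diff_right SR)
      then show "norm (blinfun_apply ((R o\<^sub>L (T o\<^sub>L S)) - id_blinfun) z) \<le> norm (T - id_blinfun) * norm z"
        using norm_blinfun[of "T - id_blinfun" "blinfun_apply S z"] by (simp add: iso)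
    qed simp
    then show "\<exists>T\<in>isometries UNIV. blinfun_apply T (blinfun_apply R x) = y \<and> norm (T - id_blinfun) < e"
      using T R S by (intro bexI[of _ "R o\<^sub>L (T o\<^sub>L S)"] isometries_compose) (auto simp: SR)
  qed
qed

text \<open>Restricting to \<open>Z\<close> does not increase the distance to the identity, so the
  operators given by \<open>near\<close> restrict to members of any prescribed ball about the
  identity in the isometry group of \<open>Z\<close>.\<close>

lemma micro_transitive_subspaceI:
  assumes "subspace Z"
    and near: "\<And>x e. x \<in> unit_sphere Z \<Longrightarrow> e > 0 \<Longrightarrow> \<exists>d>0. \<forall>y\<in>unit_sphere Z. norm (x - y) < d \<longrightarrow>
      (\<exists>T\<in>isometries Z. blinfun_apply T x = y \<and> norm (T - id_blinfun) < e)"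
  shows "micro_transitive smul Z"
  unfolding micro_transitive_def
proof (intro ballI allI impI)
  interpret I: Metric_space "isometry_group smul Z" "isometry_dist smul Z"
    by (rule Metric_space_isometry[OF banach_space_over_axioms assms(1)])
  have id: "restrict id Z \<in> isometry_group smul Z"
    by (rule id_in_isometry_group[OF banach_space_over_axioms assms(1)])
  fix x U assume x: "x \<in> unit_sphere Z"
    and U: "neighborhood_in (isometry_topology smul Z) (restrict id Z) U"
  then obtain V where V: "openin I.mtopology V" "restrict id Z \<in> V" "V \<subseteq> U"
    and UG: "U \<subseteq> isometry_group smul Z"
    by (auto simp: neighborhood_in_def isometry_topology_def)
  then obtain e where e: "e > 0" "I.mball (restrict id Z) e \<subseteq> U"
    unfolding I.openin_mtopology by (meson order_trans)
  obtain d where d: "d > 0" "\<And>y. y \<in> unit_sphere Z \<Longrightarrow> norm (x - y) < d \<Longrightarrow>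
      \<exists>T\<in>isometries Z. blinfun_apply T x = y \<and> norm (T - id_blinfun) < e"
    using near[OF x e(1)] by metis
  have "(\<lambda>T. T x) ` U \<subseteq> unit_sphere Z"
    using UG x by (auto simp: unit_sphere_def isometry_group_def bounded_operators_def)
  moreover have "unit_sphere Z \<inter> ball x d \<subseteq> (\<lambda>T. T x) ` U"
  proof
    fix y assume "y \<in> unit_sphere Z \<inter> ball x d"
    then obtain T where T: "T \<in> isometries Z" "blinfun_apply T x = y" "norm (T - id_blinfun) < e"
      using d(2)[of y] by (auto simp: dist_norm)
    let ?T = "restrict (blinfun_apply T) Z"
    have "?T \<in> isometry_group smul Z"
      using T(1) restrict_contraction[OF assms(1), of T] by (auto simp: isometry_group_def isometries_def)
    moreover have "isometry_dist smul Z (restrict id Z) ?T < e"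
    proof -
      have "onorm_on Z (\<lambda>z. restrict id Z z - ?T z) = onorm_on Z (\<lambda>z. ?T z - z)"
        unfolding onorm_on_def by (intro SUP_cong) (auto simp: norm_minus_commute)
      then show ?thesis
        using onorm_on_restrict_diff[OF assms(1), of T] T(3) e(1) by (simp add: isometry_dist_def)
    qed
    ultimately have "?T \<in> U" using e(2) id by auto
    moreover have "?T x = y" using x T(2) by (simp add: unit_sphere_def)
    ultimately show "y \<in> (\<lambda>T. T x) ` U" by blast
  qed
  ultimately show "neighborhood_in (top_of_set (unit_sphere Z)) x ((\<lambda>T. T x) ` U)"
    using x d(1) unfolding neighborhood_in_def
    by (auto intro!: exI[of _ "unit_sphere Z \<inter> ball x d"] openin_open_Int)
qed

lemma micro_transitive_subspace:
  assumes "separable_space (top_of_set Y)" and mt: "micro_transitive smul UNIV"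
  obtains Z where "subspace Z" "closed Z" "separable_space (top_of_set Z)" "Y \<subseteq> Z"
    "micro_transitive smul Z"
proof -
  obtain h where h: "\<And>T. T \<in> isometries UNIV \<Longrightarrow> T o\<^sub>L h T = id_blinfun"
    using isometries_inverse by metis
  obtain Z D where Z: "subspace Z" "closed Z" "separable_space (top_of_set Z)" "Y \<subseteq> Z"
    "D \<subseteq> unit_sphere Z" "unit_sphere Z \<subseteq> closure D"
    and red: "\<forall>u\<in>D. \<forall>v\<in>D. \<forall>T\<in>isometries UNIV. \<forall>e>norm (T - id_blinfun). blinfun_apply T u = v \<longrightarrow>
       (\<exists>S\<in>isometries UNIV. blinfun_apply S u = v \<and> norm (S - id_blinfun) < e \<and>
         blinfun_apply S ` Z \<subseteq> Z \<and> blinfun_apply (h S) ` Z \<subseteq> Z)"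
    by (rule separable_reduction[OF assms(1), of "isometries UNIV" h])
  have "micro_transitive smul Z"
  proof (rule micro_transitive_subspaceI[OF Z(1)])
    fix x and e :: real assume x: "x \<in> unit_sphere Z" and e: "e > 0"
    then have nx: "norm x = 1" by (simp add: unit_sphere_def)
    \<comment> \<open>On the orbit of \<open>x\<close> a single radius works for all points, as
      \<open>closure_transitive\<close> demands.\<close>
    define D' where "D' = D \<inter> {blinfun_apply R x | R. R \<in> isometries UNIV}"
    have nD: "norm v = 1" if "v \<in> D'" for v using that Z(5) by (auto simp: D'_def unit_sphere_def)
    have near: "\<exists>d>0. \<forall>u\<in>D'. \<forall>v\<in>D'. norm (u - v) < d \<longrightarrow>
        (\<exists>T\<in>isometries Z. blinfun_apply T u = v \<and> norm (T - id_blinfun) < e)" if e': "e > 0" for e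
    proof -
      obtain d where d: "d > 0" "\<And>R y. R \<in> isometries UNIV \<Longrightarrow> norm y = 1 \<Longrightarrow> norm (blinfun_apply R x - y) < d \<Longrightarrow>
          \<exists>T\<in>isometries UNIV. blinfun_apply T (blinfun_apply R x) = y \<and> norm (T - id_blinfun) < e"
        using micro_transitive_UNIV_near_orbit[OF mt nx e'] by metis
      show ?thesis
      proof (intro exI[of _ d] conjI ballI impI d(1))
        fix u v assume uv: "u \<in> D'" "v \<in> D'" "norm (u - v) < d"
        then obtain T where "T \<in> isometries UNIV" "blinfun_apply T u = v" "norm (T - id_blinfun) < e"
          using d(2)[of _ v] nD by (auto simp: D'_def)
        then obtain S where S: "S \<in> isometries UNIV" "blinfun_apply S u = v" "norm (S - id_blinfun) < e"
            "blinfun_apply S ` Z \<subseteq> Z" "blinfun_apply (h S) ` Z \<subseteq> Z"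
          using red[rule_format, of u v T e] uv by (auto simp: D'_def)
        \<comment> \<open>Invariance of \<open>Z\<close> under the right inverse \<open>h S\<close>
          makes \<open>S\<close> map \<open>Z\<close> onto itself.\<close>
        have "z \<in> blinfun_apply S ` Z" if "z \<in> Z" for z
        proof (rule image_eqI)
          show "z = blinfun_apply S (blinfun_apply (h S) z)"
            using h[OF S(1)] by (metis blinfun_apply_blinfun_compose blinfun_apply_id_blinfun)
          show "blinfun_apply (h S) z \<in> Z" using S(5) that by blast
        qed
        then have "blinfun_apply S ` Z = Z" using S(4) by blast
        then have "S \<in> isometries Z" using S(1) by (auto simp: isometries_def contractions_def)
        then show "\<exists>T\<in>isometries Z. blinfun_apply T u = v \<and> norm (T - id_blinfun) < e"
          using S by blast
      qed
    qed
    have "\<exists>d>0. \<forall>u\<in>closure D'. \<forall>v\<in>closure D'. norm (u - v) < d \<longrightarrow>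
        (\<exists>T\<in>isometries Z. blinfun_apply T u = v \<and> norm (T - id_blinfun) < e)"
      by (rule closure_transitive[OF closed_isometries[OF Z(1,2)] isometries_compose _ near e])
        (auto simp: isometries_def contractions_def)
    then obtain d where d: "d > 0" "\<And>u v. u \<in> closure D' \<Longrightarrow> v \<in> closure D' \<Longrightarrow> norm (u - v) < d \<Longrightarrow>
        \<exists>T\<in>isometries Z. blinfun_apply T u = v \<and> norm (T - id_blinfun) < e"
      by metis
    \<comment> \<open>The tolerance 1 is an arbitrary positive choice: only the fact that all unit
      vectors near \<open>x\<close> lie on its orbit is kept.\<close>
    obtain r where r: "r > 0" "\<And>y. norm y = 1 \<Longrightarrow> norm (x - y) < r \<Longrightarrow>
        \<exists>T\<in>isometries UNIV. blinfun_apply T x = y"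
      using micro_transitive_UNIV_near[OF mt nx zero_less_one] by metis
    have "ball x r \<inter> D \<subseteq> D'"
      using r(2) Z(5) by (fastforce simp: D'_def unit_sphere_def dist_norm)
    \<comment> \<open>The ball is open, so a point of the sphere of \<open>Z\<close> inside it is a
      limit of points of \<open>D\<close> inside it, and these lie in \<open>D'\<close>. This
      applies to \<open>x\<close> itself.\<close>
    then have *: "y \<in> closure D'" if "y \<in> unit_sphere Z" "norm (x - y) < r" for y
      using that Z(6) open_Int_closure_subset[of "ball x r" D] closure_mono[of "ball x r \<inter> D" D']
      by (auto simp: dist_norm)
    show "\<exists>d>0. \<forall>y\<in>unit_sphere Z. norm (x - y) < d \<longrightarrow>
        (\<exists>T\<in>isometries Z. blinfun_apply T x = y \<and> norm (T - id_blinfun) < e)"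
      using d r(1) * x by (intro exI[of _ "min d r"]) auto
  qed
  then show thesis using that Z by blast
qed

end

theorem theorem2p6:
  fixes smul :: "'k::real_or_complex \<Rightarrow> 'x::banach \<Rightarrow> 'x" and Y :: "'x set"
  assumes "banach_space_over smul"
    and "module.subspace smul Y"
    and "separable_space (top_of_set Y)"
  shows "(uniformly_micro_semitransitive smul UNIV \<longrightarrow>
           (\<exists>Z. module.subspace smul Z \<and> closed Z \<and> separable_space (top_of_set Z) \<and> Y \<subseteq> Z \<and>
                uniformly_micro_semitransitive smul Z)) \<and>
         (micro_transitive smul UNIV \<longrightarrow>
           (\<exists>Z. module.subspace smul Z \<and> closed Z \<and> separable_space (top_of_set Z) \<and> Y \<subseteq> Z \<and>
                micro_transitive smul Z))"
proof -
  interpret banach_space_over smul by fact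
  show ?thesis
    using uniformly_micro_semitransitive_subspace[OF assms(3)] micro_transitive_subspace[OF assms(3)]
    by metis
qed

end
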